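(* Let $n\ge 2$. If $A$ is a singular $n\times n$ matrix that is row stochastic or column stochastic, then $$\operatorname{per}A\le\frac12.$$ Equality holds if and only if $A=P(J_2\oplus I_{n-2})Q$ for some $n\times n$ permutation matrices $P,Q$.
   Context: All matrices are real. The permanent of an $n\times n$ matrix $A=(a_{ij})$ is $\operatorname{per}A=\sum_{\sigma\in S_n}\prod_{i=1}^n a_{i,\sigma(i)}$. A row stochastic (resp. column stochastic) matrix is an entrywise nonnegative matrix all of whose row sums (resp. column sums) are $1$. $J_2$ is the $2\times2$ matrix with every entry $1/2$, $I_{n-2}$ is the identity matrix of order $n-2$ (absent when $n=2$), and $\oplus$ denotes the block diagonal direct sum. *)

theory Defs
  imports Complex_Main "Jordan_Normal_Form.Determinant"
begin

(* As for det, the value on non-square matrices is a dummy. *)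
definition permanent :: "'a :: comm_ring_1 mat \<Rightarrow> 'a" where
  "permanent A = (if dim_row A = dim_col A then
     (\<Sum>\<sigma> \<in> {\<sigma>. \<sigma> permutes {0..<dim_row A}}. \<Prod>i = 0..<dim_row A. A $$ (i, \<sigma> i)) else 0)"

definition row_stochastic :: "real mat \<Rightarrow> bool" where
  "row_stochastic A \<longleftrightarrow>
     (\<forall>i < dim_row A. \<forall>j < dim_col A. 0 \<le> A $$ (i, j)) \<and>
     (\<forall>i < dim_row A. (\<Sum>j = 0..<dim_col A. A $$ (i, j)) = 1)"

definition column_stochastic :: "real mat \<Rightarrow> bool" where
  "column_stochastic A \<longleftrightarrow>
     (\<forall>i < dim_row A. \<forall>j < dim_col A. 0 \<le> A $$ (i, j)) \<and>
     (\<forall>j < dim_col A. (\<Sum>i = 0..<dim_row A. A $$ (i, j)) = 1)"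

definition permutation_mat :: "nat \<Rightarrow> real mat \<Rightarrow> bool" where
  "permutation_mat n P \<longleftrightarrow>
     (\<exists>\<sigma>. \<sigma> permutes {0..<n} \<and> P = mat n n (\<lambda>(i, j). if j = \<sigma> i then 1 else 0))"

definition J2 :: "real mat" where
  "J2 = mat 2 2 (\<lambda>_. 1 / 2)"

end

theory Submission
  imports Defs
begin

text \<open>
  Let \<open>A\<close> be row stochastic and \<open>A x = 0\<close> with \<open>x \<noteq> 0\<close>. Let every row choose a column at random,
  independently, row \<open>i\<close> choosing \<open>j\<close> with probability \<open>a i j\<close>. Then \<open>per A\<close> is the probability that
  the choices form a permutation. The idea is to find other events, disjoint from this one, whose
  total probability is at least \<open>per A\<close>.

  For \<open>p \<noteq> j\<close> let \<open>\<pi>(p, j)\<close> be the probability that column \<open>p\<close> is missed, column \<open>j\<close> is chosen twice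
  and all other columns once. Replacing column \<open>p\<close> by column \<open>j\<close> gives a matrix with permanent
  \<open>2 * \<pi>(p, j)\<close>. As the permanent is linear in column \<open>p\<close> and \<open>\<Sum>j. x j * (column j) = 0\<close>,
  this yields \<open>x p * per A + 2 * (\<Sum>j \<noteq> p. x j * \<pi>(p, j)) = 0\<close> (lemma \<open>kernel_mass\<close>).

  Let \<open>X = x p\<close> be the largest positive coordinate and \<open>- Y = x q\<close> the smallest negative one;
  both exist if \<open>per A > 0\<close>. The identity gives \<open>X * per A \<le> 2 * Y * R\<close>, where \<open>R\<close> is the sum of
  \<open>\<pi>(p, j)\<close> over negative coordinates \<open>j\<close>, and \<open>Y * per A \<le> 2 * X * C\<close>, where \<open>C\<close> is the sum of
  \<open>\<pi>(q, j)\<close> over positive coordinates \<open>j\<close>. Hence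
  \<open>R + C \<ge> per A * (X / Y + Y / X) / 2 \<ge> per A\<close>. The events are disjoint, so \<open>2 * per A \<le> 1\<close>
  (lemma \<open>mass_le_half\<close>).

  If \<open>per A = 1 / 2\<close>, then \<open>X = Y\<close> and these events exhaust the whole probability. This leaves \<open>p\<close>
  and \<open>q\<close> as the only nonzero coordinates, makes every column other than \<open>p\<close> and \<open>q\<close> chosen exactly
  once with certainty, and so determines all entries (lemma \<open>equality_structure\<close>). The column
  stochastic case follows by transposition.
\<close>

section \<open>Maps of rows to columns and their types\<close>

definition weight :: "'a set \<Rightarrow> ('a \<Rightarrow> 'a \<Rightarrow> real) \<Rightarrow> ('a \<Rightarrow> 'a) \<Rightarrow> real" where
  "weight I a f = (\<Prod>i\<in>I. a i (f i))"

text \<open>For \<open>p\<close>, \<open>j\<close> in \<open>I\<close>, a map of type \<open>(p, j)\<close> with \<open>p \<noteq> j\<close> misses column \<open>p\<close>, hits column \<open>j\<close> twice and every other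
  column once; for \<open>p = j\<close> it is a permutation of \<open>I\<close>. Writing the fibre condition with sums in place
  of differences lets one formula cover all these cases over the natural numbers.\<close>

definition defect :: "'a set \<Rightarrow> 'a \<Rightarrow> 'a \<Rightarrow> ('a \<Rightarrow> 'a) set" where
  "defect I p j = {f \<in> I \<rightarrow>\<^sub>E I.
     \<forall>k\<in>I. card {i \<in> I. f i = k} + of_bool (k = p) = 1 + of_bool (k = j)}"

abbreviation transversals :: "'a set \<Rightarrow> ('a \<Rightarrow> 'a) set" where
  "transversals I \<equiv> {f \<in> I \<rightarrow>\<^sub>E I. \<forall>k\<in>I. card {i \<in> I. f i = k} = 1}"

definition mass :: "'a set \<Rightarrow> ('a \<Rightarrow> 'a \<Rightarrow> real) \<Rightarrow> 'a \<Rightarrow> 'a \<Rightarrow> real" where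
  "mass I a p j = (\<Sum>f\<in>defect I p j. weight I a f)"

lemma defect_refl: "defect I p p = transversals I"
  by (auto simp: defect_def)

lemma finite_defect: "finite I \<Longrightarrow> finite (defect I p j)"
  by (rule finite_subset[of _ "I \<rightarrow>\<^sub>E I"]) (auto simp: defect_def intro: finite_PiE)

text \<open>Redirecting row \<open>i\<close> from column \<open>f i\<close> to column \<open>j\<close> moves one unit between two fibre sizes. All
  the bookkeeping with types rests on this identity.\<close>

lemma card_fibre_fun_upd:
  assumes "finite I" and "i \<in> I"
  shows "card {i' \<in> I. (f(i := j)) i' = k} + of_bool (k = f i)
       = card {i' \<in> I. f i' = k} + of_bool (k = j)"
proof -
  let ?R = "{i' \<in> I - {i}. f i' = k}"
  have split: "card {i' \<in> I. g i' = k} = card ?R + of_bool (k = g i)"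
    if "\<And>i'. i' \<noteq> i \<Longrightarrow> g i' = f i'" for g
  proof -
    have "{i' \<in> I. g i' = k} = (if k = g i then insert i ?R else ?R)"
      using that assms by (cases "k = g i") (auto, metis+)
    then show ?thesis using assms by auto
  qed
  show ?thesis using split[of f] split[of "f(i := j)"] by simp
qed

text \<open>Together with the next lemma: the maps of type \<open>(p, j)\<close> with \<open>f i = j\<close> are exactly the
  permutations sending \<open>i\<close> to \<open>p\<close>, redirected at \<open>i\<close> to \<open>j\<close>.\<close>

lemma fun_upd_transversal:
  assumes "finite I" "\<sigma> \<in> transversals I" "i \<in> I" "k \<in> I"
  shows "\<sigma>(i := k) \<in> defect I (\<sigma> i) k"
proof -
  have "\<sigma>(i := k) \<in> I \<rightarrow>\<^sub>E I" using assms by (auto intro: fun_upd_in_PiE)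
  moreover have "card {i' \<in> I. (\<sigma>(i := k)) i' = l} + of_bool (l = \<sigma> i) = 1 + of_bool (l = k)"
    if "l \<in> I" for l
    using card_fibre_fun_upd[OF assms(1,3), of \<sigma> k l] assms(2) that by simp
  ultimately show ?thesis unfolding defect_def by blast
qed

lemma fun_upd_defect:
  assumes "finite I" "f \<in> defect I p (f i)" "i \<in> I" "p \<in> I"
  shows "f(i := p) \<in> transversals I"
proof -
  have "f(i := p) \<in> I \<rightarrow>\<^sub>E I" using assms by (auto simp: defect_def intro: fun_upd_in_PiE)
  moreover have "card {i' \<in> I. (f(i := p)) i' = l} = 1"
    if "l \<in> I" for l
  proof -
    have "card {i' \<in> I. f i' = l} + of_bool (l = p) = 1 + of_bool (l = f i)"
      using assms(2) that by (simp add: defect_def)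
    then show ?thesis
      using card_fibre_fun_upd[OF assms(1,3), of f p l] by simp
  qed
  ultimately show ?thesis by blast
qed

text \<open>A type with distinct entries is read off from the fibres: the missed column and the doubled one.
  Types \<open>(p, p)\<close> all coincide, which is why one of the two types must be proper.\<close>

lemma defect_disjoint:
  assumes "f \<in> defect I p j" "f \<in> defect I p' j'" "p \<in> I" "j \<in> I" "p' \<in> I" "j' \<in> I" "p \<noteq> j"
  shows "p = p' \<and> j = j'"
proof -
  have c: "card {i \<in> I. f i = k} + of_bool (k = p) = 1 + of_bool (k = j)"
          "card {i \<in> I. f i = k} + of_bool (k = p') = 1 + of_bool (k = j')" if "k \<in> I" for k
    using assms that by (auto simp: defect_def)
  show ?thesis
    using c[OF assms(3)] c[OF assms(4)] assms(7) by (auto simp: of_bool_def split: if_splits)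
qed

lemma weight_fun_upd:
  assumes "finite I" "i \<in> I"
  shows "weight I a (f(i := j)) = a i j * (\<Prod>i'\<in>I - {i}. a i' (f i'))"
  unfolding weight_def by (subst prod.remove[OF assms]) (auto intro!: prod.cong)

text \<open>The sum of \<open>X\<close> times the first hypothesis and \<open>Y\<close> times the second. It will be
  combined with \<open>2 * X * Y \<le> X\<^sup>2 + Y\<^sup>2\<close>.\<close>

lemma two_sided_estimate:
  fixes X Y m R C :: real
  assumes "0 < X" "0 < Y" "X * m \<le> 2 * Y * R" "Y * m \<le> 2 * X * C"
  shows "m * (X\<^sup>2 + Y\<^sup>2) \<le> 2 * (R + C) * (X * Y)"
proof -
  have "X * (X * m) \<le> X * (2 * Y * R)" "Y * (Y * m) \<le> Y * (2 * X * C)"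
    using assms by (intro mult_left_mono; simp)+
  then show ?thesis by (simp add: algebra_simps power2_eq_square)
qed

section \<open>Stochastic matrices with a kernel vector\<close>

text \<open>A row stochastic matrix together with a vector \<open>x\<close> in its right kernel. These conditions are
  preserved by \<open>x \<mapsto> - x\<close>, so each statement on positive coordinates has a mirror image.\<close>

locale stochastic_kernel =
  fixes I :: "'a set" and a :: "'a \<Rightarrow> 'a \<Rightarrow> real" and x :: "'a \<Rightarrow> real"
  assumes finite_index: "finite I"
    and nonneg: "i \<in> I \<Longrightarrow> j \<in> I \<Longrightarrow> 0 \<le> a i j"
    and row_sum: "i \<in> I \<Longrightarrow> (\<Sum>j\<in>I. a i j) = 1"
    and kernel: "i \<in> I \<Longrightarrow> (\<Sum>j\<in>I. x j * a i j) = 0"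
begin

lemma weight_nonneg: "f \<in> I \<rightarrow>\<^sub>E I \<Longrightarrow> 0 \<le> weight I a f"
  unfolding weight_def by (intro prod_nonneg) (auto intro: nonneg)

text \<open>Expanding the product of the row sums. If the rows choose columns independently with the given
  probabilities, the weight of a map is its probability.\<close>

lemma total_weight: "(\<Sum>f\<in>I \<rightarrow>\<^sub>E I. weight I a f) = 1"
proof -
  have "(\<Prod>i\<in>I. \<Sum>j\<in>I. a i j) = (\<Sum>f\<in>I \<rightarrow>\<^sub>E I. weight I a f)"
    unfolding weight_def using finite_index by (intro prod_sum_PiE) auto
  then show ?thesis using row_sum by simp
qed

lemma mass_nonneg: "0 \<le> mass I a p j"
  unfolding mass_def by (intro sum_nonneg weight_nonneg) (auto simp: defect_def)

text \<open>This is the expansion of \<open>\<Sum>j. x j * per A\<^sub>j = 0\<close>, where \<open>A\<^sub>j\<close> is the matrix with column \<open>p\<close>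
  replaced by column \<open>j\<close>: the permanent is linear in that column, and \<open>x\<close> is a kernel vector. For
  \<open>j \<noteq> p\<close> a map of type \<open>(p, j)\<close> is counted in \<open>per A\<^sub>j\<close> once for each of the two rows that it
  sends to \<open>j\<close>, which explains the factor \<open>2\<close>. The proof sums over the row \<open>i\<close> that the
  permutation sends to \<open>p\<close>, and for fixed \<open>i\<close> the sum over \<open>j\<close> is the kernel equation of row \<open>i\<close>.\<close>

lemma kernel_mass:
  assumes p: "p \<in> I"
  shows "(\<Sum>j\<in>I. x j * ((1 + of_bool (j \<noteq> p)) * mass I a p j)) = 0"
proof -
  note [simp] = finite_index finite_defect[OF finite_index]
  let ?T = "\<lambda>i. {\<sigma> \<in> transversals I. \<sigma> i = p}"
  have fT: "finite (?T i)" for i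
    by (rule finite_subset[of _ "I \<rightarrow>\<^sub>E I"]) (auto intro: finite_PiE)
  have row: "(\<Sum>j\<in>I. \<Sum>f\<in>{f \<in> defect I p j. f i = j}. x j * weight I a f) = 0"
    if i: "i \<in> I" for i
  proof -
    have "(\<Sum>j\<in>I. \<Sum>f\<in>{f \<in> defect I p j. f i = j}. x j * weight I a f)
        = (\<Sum>(j, f)\<in>(SIGMA j:I. {f \<in> defect I p j. f i = j}). x j * weight I a f)"
      by (intro sum.Sigma) auto
    also have "\<dots> = (\<Sum>(\<sigma>, j)\<in>?T i \<times> I. x j * weight I a (\<sigma>(i := j)))"
    proof (rule sum.reindex_bij_witness[where i = "\<lambda>(\<sigma>, j). (j, \<sigma>(i := j))"
          and j = "\<lambda>(j, f). (f(i := p), j)"])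
      fix y assume "y \<in> (SIGMA j:I. {f \<in> defect I p j. f i = j})"
      then show "(case y of (j, f) \<Rightarrow> (f(i := p), j)) \<in> ?T i \<times> I"
        using fun_upd_defect[OF finite_index _ i p] by auto
    next
      fix y assume y: "y \<in> ?T i \<times> I"
      then show "(case y of (\<sigma>, j) \<Rightarrow> (j, \<sigma>(i := j)))
          \<in> (SIGMA j:I. {f \<in> defect I p j. f i = j})"
        using fun_upd_transversal[OF finite_index _ i] by fastforce
    qed auto
    also have "\<dots> = (\<Sum>\<sigma>\<in>?T i. \<Sum>j\<in>I. x j * weight I a (\<sigma>(i := j)))"
      using fT by (intro sum.Sigma[symmetric]) auto
    also have "\<dots> = (\<Sum>\<sigma>\<in>?T i. (\<Sum>j\<in>I. x j * a i j) * (\<Prod>i'\<in>I - {i}. a i' (\<sigma> i')))"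
      by (simp add: weight_fun_upd i sum_distrib_right mult.assoc)
    finally show ?thesis using kernel[OF i] by simp
  qed
  have count: "card {i \<in> I. f i = j} = 1 + of_bool (j \<noteq> p)" if "f \<in> defect I p j" "j \<in> I" for f j
  proof -
    have "card {i \<in> I. f i = j} + of_bool (j = p) = 1 + of_bool (j = j)"
      using that unfolding defect_def by blast
    then show ?thesis by (auto split: if_splits)
  qed
  have col: "x j * ((1 + of_bool (j \<noteq> p)) * mass I a p j)
      = (\<Sum>i\<in>I. \<Sum>f\<in>{f \<in> defect I p j. f i = j}. x j * weight I a f)" if j: "j \<in> I" for j
  proof -
    have "x j * ((1 + of_bool (j \<noteq> p)) * mass I a p j)
        = (\<Sum>f\<in>defect I p j. of_nat (card {i \<in> I. f i = j}) * (x j * weight I a f))"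
      unfolding mass_def sum_distrib_left
      by (intro sum.cong refl) (simp add: count[OF _ j] algebra_simps)
    also have "\<dots> = (\<Sum>f\<in>defect I p j. \<Sum>i\<in>{i \<in> I. f i = j}. x j * weight I a f)"
      by simp
    also have "\<dots> = (\<Sum>i\<in>I. \<Sum>f\<in>{f \<in> defect I p j. f i = j}. x j * weight I a f)"
      by (rule sum.swap_restrict) auto
    finally show ?thesis .
  qed
  have "(\<Sum>j\<in>I. x j * ((1 + of_bool (j \<noteq> p)) * mass I a p j))
      = (\<Sum>j\<in>I. \<Sum>i\<in>I. \<Sum>f\<in>{f \<in> defect I p j. f i = j}. x j * weight I a f)"
    by (rule sum.cong) (auto simp: col)
  also have "\<dots> = 0" by (subst sum.swap) (simp add: row)
  finally show ?thesis .
qed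

text \<open>In the kernel identity at \<open>p\<close>, the terms with \<open>x j > 0\<close>, \<open>j \<noteq> p\<close>, have the same sign as the
  permanent term and are dropped; the others must compensate for it.\<close>

lemma pos_coordinate_bound:
  assumes p: "p \<in> I" "0 < x p"
  shows "x p * mass I a p p \<le> 2 * (\<Sum>j | j \<in> I \<and> x j < 0. - x j * mass I a p j)"
proof -
  note [simp] = finite_index
  let ?g = "\<lambda>j. x j * ((1 + of_bool (j \<noteq> p)) * mass I a p j)"
  have "x p * mass I a p p = ?g p" by simp
  also have "\<dots> \<le> (\<Sum>j | j \<in> I \<and> \<not> x j < 0. ?g j)"
    using p mass_nonneg by (intro member_le_sum) auto
  also have "\<dots> = - (\<Sum>j | j \<in> I \<and> x j < 0. ?g j)"
  proof -
    have "(\<Sum>j\<in>I. ?g j) = (\<Sum>j | j \<in> I \<and> x j < 0. ?g j) + (\<Sum>j | j \<in> I \<and> \<not> x j < 0. ?g j)"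
      by (subst sum.union_disjoint[symmetric]) (auto intro!: sum.cong)
    then show ?thesis using kernel_mass[OF p(1)] by simp
  qed
  also have "\<dots> = 2 * (\<Sum>j | j \<in> I \<and> x j < 0. - x j * mass I a p j)"
    unfolding sum_negf[symmetric] sum_distrib_left using p
    by (intro sum.cong) auto
  finally show ?thesis .
qed

lemma stochastic_kernel_uminus: "stochastic_kernel I a (\<lambda>j. - x j)"
  using finite_index nonneg row_sum kernel by unfold_locales (auto simp: sum_negf)

lemma neg_coordinate_bound:
  assumes q: "q \<in> I" "x q < 0"
  shows "- x q * mass I a q q \<le> 2 * (\<Sum>j | j \<in> I \<and> 0 < x j. x j * mass I a q j)"
  using stochastic_kernel.pos_coordinate_bound[OF stochastic_kernel_uminus, of q] q by simp

lemma mass_refl: "mass I a p p = mass I a q q"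
  by (simp add: mass_def defect_refl)

lemma pos_mass_imp_weight:
  assumes "0 < mass I a p j"
  obtains f where "f \<in> defect I p j" "0 < weight I a f"
proof -
  have "\<exists>f\<in>defect I p j. 0 < weight I a f"
  proof (rule ccontr)
    assume "\<not> ?thesis"
    then have "mass I a p j \<le> 0" unfolding mass_def by (intro sum_nonpos) force
    with assms show False by simp
  qed
  then show ?thesis using that by blast
qed

text \<open>The types that occur in the bounds at a positive coordinate \<open>p\<close> and a negative coordinate \<open>q\<close>:
  permutations, represented by \<open>(p, p)\<close>, column \<open>p\<close> missing and a negative column doubled, column
  \<open>q\<close> missing and a positive column doubled. They exclude one another, so their probabilities add
  up to at most one.\<close>

definition extremal_types :: "'a \<Rightarrow> 'a \<Rightarrow> ('a \<times> 'a) set" where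
  "extremal_types p q = insert (p, p) ({p} \<times> {j \<in> I. x j < 0} \<union> {q} \<times> {j \<in> I. 0 < x j})"

lemma extremal_types_weight:
  assumes p: "p \<in> I" "0 < x p" and q: "q \<in> I" "x q < 0"
  shows "(\<Sum>f\<in>(\<Union>(r, j)\<in>extremal_types p q. defect I r j). weight I a f)
       = mass I a p p + (\<Sum>j | j \<in> I \<and> x j < 0. mass I a p j)
         + (\<Sum>j | j \<in> I \<and> 0 < x j. mass I a q j)"
proof -
  note [simp] = finite_index finite_defect[OF finite_index]
  have fin: "finite (extremal_types p q)" by (simp add: extremal_types_def)
  have "(\<Sum>f\<in>(\<Union>(r, j)\<in>extremal_types p q. defect I r j). weight I a f)
      = (\<Sum>y\<in>extremal_types p q. \<Sum>f\<in>(case y of (r, j) \<Rightarrow> defect I r j). weight I a f)"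
  proof (rule sum.UNION_disjoint[OF fin])
    show "\<forall>y\<in>extremal_types p q. \<forall>z\<in>extremal_types p q. y \<noteq> z \<longrightarrow>
        (case y of (r, j) \<Rightarrow> defect I r j) \<inter> (case z of (r, j) \<Rightarrow> defect I r j) = {}"
    proof (intro ballI impI equals0I)
      fix y z f
      assume *: "y \<in> extremal_types p q" "z \<in> extremal_types p q" "y \<noteq> z"
        "f \<in> (case y of (r, j) \<Rightarrow> defect I r j) \<inter> (case z of (r, j) \<Rightarrow> defect I r j)"
      obtain r j r' j' where yz: "y = (r, j)" "z = (r', j')" by (cases y, cases z)
      have f: "f \<in> defect I r j" "f \<in> defect I r' j'" using * yz by auto
      have mem: "r \<in> I" "j \<in> I" "r' \<in> I" "j' \<in> I"
        using *(1,2) yz p q by (auto simp: extremal_types_def)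
      have "r \<noteq> j \<or> r' \<noteq> j'" using * yz p q by (auto simp: extremal_types_def)
      then have "r = r' \<and> j = j'"
        using defect_disjoint[OF f mem] defect_disjoint[OF f(2,1) mem(3,4,1,2)] by blast
      then show False using *(3) yz by blast
    qed
  qed auto
  also have "\<dots> = (\<Sum>(r, j)\<in>extremal_types p q. mass I a r j)"
    by (intro sum.cong) (auto simp: mass_def)
  also have "\<dots> = mass I a p p + (\<Sum>(r, j)\<in>{p} \<times> {j \<in> I. x j < 0} \<union> {q} \<times> {j \<in> I. 0 < x j}. mass I a r j)"
    unfolding extremal_types_def using p q by (subst sum.insert) auto
  also have "(\<Sum>(r, j)\<in>{p} \<times> {j \<in> I. x j < 0} \<union> {q} \<times> {j \<in> I. 0 < x j}. mass I a r j)
     = (\<Sum>(r, j)\<in>{p} \<times> {j \<in> I. x j < 0}. mass I a r j)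
     + (\<Sum>(r, j)\<in>{q} \<times> {j \<in> I. 0 < x j}. mass I a r j)"
    using p q by (intro sum.union_disjoint) auto
  also have "(\<Sum>(r, j)\<in>{p} \<times> {j \<in> I. x j < 0}. mass I a r j) = (\<Sum>j | j \<in> I \<and> x j < 0. mass I a p j)"
    by (simp add: sum.cartesian_product[symmetric])
  also have "(\<Sum>(r, j)\<in>{q} \<times> {j \<in> I. 0 < x j}. mass I a r j) = (\<Sum>j | j \<in> I \<and> 0 < x j. mass I a q j)"
    by (simp add: sum.cartesian_product[symmetric])
  finally show ?thesis by simp
qed

lemma extremal_types_subset: "(\<Union>(r, j)\<in>extremal_types p q. defect I r j) \<subseteq> I \<rightarrow>\<^sub>E I"
  by (auto simp: defect_def)

lemma extremal_types_weight_le_1: "(\<Sum>f\<in>(\<Union>(r, j)\<in>extremal_types p q. defect I r j). weight I a f) \<le> 1"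
  unfolding total_weight[symmetric]
  using extremal_types_subset finite_index by (intro sum_mono2 weight_nonneg) (auto intro: finite_PiE)

text \<open>If all nonzero coordinates had the same sign, the bound at one of them would have an empty sum on
  the right and a positive number on the left.\<close>

lemma ex_opposite_signs:
  assumes "j \<in> I" "x j \<noteq> 0" and m: "0 < mass I a j j"
  shows "\<exists>p\<in>I. 0 < x p" and "\<exists>q\<in>I. x q < 0"
proof -
  have neg: "\<exists>q\<in>I. x q < 0" if "p \<in> I" "0 < x p" for p
  proof (rule ccontr)
    assume "\<not> ?thesis"
    then have "{j \<in> I. x j < 0} = {}" by auto
    then show False
      using pos_coordinate_bound[OF that] mult_pos_pos[OF that(2) m] mass_refl[of p j] by (simp only:) simp
  qed
  have pos: "\<exists>p\<in>I. 0 < x p" if "q \<in> I" "x q < 0" for q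
  proof (rule ccontr)
    assume "\<not> ?thesis"
    then have "{j \<in> I. 0 < x j} = {}" by auto
    then show False
      using neg_coordinate_bound[OF that] mult_neg_pos[OF that(2) m] mass_refl[of q j] by (simp only:) simp
  qed
  show "\<exists>p\<in>I. 0 < x p" "\<exists>q\<in>I. x q < 0"
    using neg pos assms(1,2) by (meson linorder_neqE_linordered_idom)+
qed

text \<open>Take \<open>p\<close> and \<open>q\<close> maximizing \<open>\<bar>x\<bar>\<close> among the positive and among the negative coordinates;
  then \<open>\<bar>x j\<bar>\<close> can be replaced by \<open>\<bar>x q\<bar>\<close> in the bound at \<open>p\<close>, and by \<open>\<bar>x p\<bar>\<close> in the bound at \<open>q\<close>.\<close>

lemma extremal_pair:
  assumes j: "j \<in> I" "x j \<noteq> 0" and m: "0 < mass I a j j"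
  obtains p q where "p \<in> I" "0 < x p" "q \<in> I" "x q < 0"
    "x p * mass I a j j \<le> 2 * (- x q) * (\<Sum>j | j \<in> I \<and> x j < 0. mass I a p j)"
    "- x q * mass I a j j \<le> 2 * x p * (\<Sum>j | j \<in> I \<and> 0 < x j. mass I a q j)"
proof -
  let ?P = "{j \<in> I. 0 < x j}" and ?N = "{j \<in> I. x j < 0}"
  have fin: "finite ?P" "finite ?N" using finite_index by auto
  have ne: "?P \<noteq> {}" "?N \<noteq> {}" using ex_opposite_signs[OF assms] by auto
  obtain p where p: "p \<in> ?P" "\<And>j. j \<in> ?P \<Longrightarrow> x j \<le> x p"
    using Max_in[of "x ` ?P"] Max_ge[of "x ` ?P"] ne fin by fastforce
  obtain q where q: "q \<in> ?N" "\<And>j. j \<in> ?N \<Longrightarrow> x q \<le> x j"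
    using Min_in[of "x ` ?N"] Min_le[of "x ` ?N"] ne fin by fastforce
  have "(\<Sum>j\<in>?N. - x j * mass I a p j) \<le> (\<Sum>j\<in>?N. - x q * mass I a p j)"
    using q mass_nonneg by (intro sum_mono mult_right_mono) auto
  then have 1: "x p * mass I a j j \<le> 2 * (- x q) * (\<Sum>j\<in>?N. mass I a p j)"
    using pos_coordinate_bound[of p] p mass_refl[of p j] unfolding sum_distrib_left[symmetric] by simp
  have "(\<Sum>j\<in>?P. x j * mass I a q j) \<le> (\<Sum>j\<in>?P. x p * mass I a q j)"
    using p mass_nonneg by (intro sum_mono mult_right_mono) auto
  then have 2: "- x q * mass I a j j \<le> 2 * x p * (\<Sum>j\<in>?P. mass I a q j)"
    using neg_coordinate_bound[of q] q mass_refl[of q j] unfolding sum_distrib_left[symmetric] by simp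
  show ?thesis using that[of p q] 1 2 p q by simp
qed

text \<open>All masses \<open>mass I a j j\<close> are equal to the permanent. For an extremal pair, the two bounds
  combine to \<open>per A \<le> R + C\<close>, where \<open>R\<close> and \<open>C\<close> are the probabilities that \<open>p\<close> is missed and a
  negative column doubled, and that \<open>q\<close> is missed and a positive column doubled. Disjointness gives
  \<open>per A + R + C \<le> 1\<close>.\<close>

lemma mass_le_half:
  assumes j: "j \<in> I" "x j \<noteq> 0"
  shows "mass I a j j \<le> 1 / 2"
proof (cases "0 < mass I a j j")
  case True
  obtain p q where pq: "p \<in> I" "0 < x p" "q \<in> I" "x q < 0"
    and est: "x p * mass I a j j \<le> 2 * (- x q) * (\<Sum>j | j \<in> I \<and> x j < 0. mass I a p j)"
    "- x q * mass I a j j \<le> 2 * x p * (\<Sum>j | j \<in> I \<and> 0 < x j. mass I a q j)"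
    using extremal_pair[OF j True] .
  let ?R = "\<Sum>j | j \<in> I \<and> x j < 0. mass I a p j" and ?C = "\<Sum>j | j \<in> I \<and> 0 < x j. mass I a q j"
  have "mass I a j j * ((x p)\<^sup>2 + (- x q)\<^sup>2) \<le> 2 * (?R + ?C) * (x p * - x q)"
    using pq est by (intro two_sided_estimate) auto
  moreover have "mass I a j j * (2 * (x p * - x q)) \<le> mass I a j j * ((x p)\<^sup>2 + (- x q)\<^sup>2)"
    using sum_squares_bound[of "x p" "- x q"] True by (intro mult_left_mono) auto
  ultimately have "mass I a j j * (2 * (x p * - x q)) \<le> (?R + ?C) * (2 * (x p * - x q))"
    by (simp add: algebra_simps)
  then have "mass I a j j \<le> ?R + ?C"
    using pq by (subst (asm) mult_le_cancel_right_pos) (auto intro: mult_pos_neg)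
  moreover have "mass I a j j + ?R + ?C \<le> 1"
    using extremal_types_weight_le_1[of p q] extremal_types_weight[OF pq] mass_refl[of p j] by simp
  ultimately show ?thesis by simp
qed simp

text \<open>Equality forces \<open>x q = - x p\<close> for the extremal pair and leaves no probability outside the extremal
  types. Any other negative coordinate \<open>q'\<close> would, by its own bound, give positive probability to some
  type \<open>(q', k)\<close>, which is not extremal; so \<open>p\<close> and \<open>q\<close> are the only nonzero coordinates of
  \<open>x\<close>. Redirecting one row of a permutation of positive weight along a positive entry must
  again produce a map of extremal type, which leaves just the entries of a permuted direct sum of \<open>J2\<close> and an identity matrix.\<close>

lemma equality_structure:
  assumes j: "j \<in> I" "x j \<noteq> 0" and m: "mass I a j j = 1 / 2"
  obtains p q \<sigma> where "p \<in> I" "q \<in> I" "p \<noteq> q" "\<sigma> \<in> transversals I"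
    "\<forall>i\<in>I. \<forall>k\<in>I.
       a i k = (if \<sigma> i \<in> {p, q} then if k \<in> {p, q} then 1 / 2 else 0 else of_bool (k = \<sigma> i))"
proof -
  note [simp] = finite_index
  have m0: "0 < mass I a j j" using m by simp
  let ?P = "{j \<in> I. 0 < x j}" and ?N = "{j \<in> I. x j < 0}"
  obtain p q where pq: "p \<in> I" "0 < x p" "q \<in> I" "x q < 0"
    and est: "x p * mass I a j j \<le> 2 * (- x q) * (\<Sum>j\<in>?N. mass I a p j)"
    "- x q * mass I a j j \<le> 2 * x p * (\<Sum>j\<in>?P. mass I a q j)"
    using extremal_pair[OF j m0] .
  let ?R = "\<Sum>j\<in>?N. mass I a p j" and ?C = "\<Sum>j\<in>?P. mass I a q j"
  let ?U = "\<Union>(r, j)\<in>extremal_types p q. defect I r j"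
  have U: "sum (weight I a) ?U = 1 / 2 + ?R + ?C"
    using extremal_types_weight[OF pq] mass_refl[of p j] m by simp
  have main: "((x p)\<^sup>2 + (- x q)\<^sup>2) / 2 \<le> 2 * (?R + ?C) * (x p * - x q)"
    using two_sided_estimate[OF _ _ est] pq m by simp
  have RC: "?R + ?C \<le> 1 / 2" using U extremal_types_weight_le_1[of p q] by simp
  have XY_pos: "0 < x p * - x q" using pq by (auto intro: mult_pos_neg)
  have "2 * (?R + ?C) * (x p * - x q) \<le> 1 * (x p * - x q)"
    using RC XY_pos by (intro mult_right_mono) auto
  with main have "((x p)\<^sup>2 + (- x q)\<^sup>2) / 2 \<le> x p * - x q" by simp
  then have "(x p + x q)\<^sup>2 \<le> 0" by (simp add: power2_eq_square algebra_simps)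
  then have opp: "x q = - x p" by simp
  have "((x p)\<^sup>2 + (- x q)\<^sup>2) / 2 = 1 * (x p * - x q)"
    using opp by (simp add: power2_eq_square)
  with main have "1 * (x p * - x q) \<le> 2 * (?R + ?C) * (x p * - x q)" by simp
  then have "1 \<le> 2 * (?R + ?C)"
    using XY_pos by (subst (asm) mult_le_cancel_right_pos) auto
  then have U1: "sum (weight I a) ?U = 1" using U RC by simp
  \<comment> \<open>The extremal types already exhaust the total weight.\<close>
  have in_U: "f \<in> ?U" if f: "f \<in> I \<rightarrow>\<^sub>E I" "0 < weight I a f" for f
  proof (rule ccontr)
    have fin: "finite (I \<rightarrow>\<^sub>E I)" by (intro finite_PiE) auto
    assume "f \<notin> ?U"
    then have "weight I a f + sum (weight I a) ?U = sum (weight I a) (insert f ?U)"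
      using finite_subset[OF extremal_types_subset fin] by (intro sum.insert[symmetric])
    also have "\<dots> \<le> (\<Sum>f\<in>I \<rightarrow>\<^sub>E I. weight I a f)"
    proof (rule sum_mono2[OF fin])
      show "insert f ?U \<subseteq> I \<rightarrow>\<^sub>E I" using extremal_types_subset f(1) by (rule insert_subsetI[rotated])
    qed (use weight_nonneg in blast)
    finally show False using f(2) U1 total_weight by simp
  qed
  have in_types: "(r, k) \<in> extremal_types p q" if "f \<in> defect I r k" "0 < weight I a f" "r \<in> I" "k \<in> I" "r \<noteq> k" for f r k
  proof -
    have "f \<in> ?U" using in_U that by (auto simp: defect_def)
    then obtain r' k' where *: "(r', k') \<in> extremal_types p q" "f \<in> defect I r' k'" by auto
    then have "r' \<in> I" "k' \<in> I" using pq by (auto simp: extremal_types_def)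
    then show ?thesis using defect_disjoint[OF that(1) *(2)] that * by auto
  qed
  have N: "q' = q" if q': "q' \<in> I" "x q' < 0" for q'
  proof -
    have "0 < - x q' * mass I a j j" using q' m0 by (simp add: mult_neg_pos)
    then have "0 < (\<Sum>j\<in>?P. x j * mass I a q' j)"
      using neg_coordinate_bound[OF q'] mass_refl[of q' j] by simp
    then obtain k where k: "k \<in> ?P" "0 < x k * mass I a q' k"
      using sum_nonpos by (meson not_less)
    then have "0 < mass I a q' k" by (simp add: zero_less_mult_iff)
    then obtain f where f: "f \<in> defect I q' k" "0 < weight I a f" by (rule pos_mass_imp_weight)
    have "q' \<noteq> k" using q'(2) k(1) by auto
    then have "(q', k) \<in> extremal_types p q" using in_types[OF f q'(1)] k(1) by blast
    then show ?thesis using q' pq k by (auto simp: extremal_types_def)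
  qed
  have P: "p' = p" if p': "p' \<in> I" "0 < x p'" for p'
  proof -
    have "0 < x p' * mass I a j j" using p' m0 by simp
    then have "0 < (\<Sum>j\<in>?N. - x j * mass I a p' j)"
      using pos_coordinate_bound[OF p'] mass_refl[of p' j] by simp
    then obtain k where k: "k \<in> ?N" "0 < - x k * mass I a p' k"
      using sum_nonpos by (meson not_less)
    then have "0 < mass I a p' k" by (auto simp: zero_less_mult_iff mult_less_0_iff)
    then obtain f where f: "f \<in> defect I p' k" "0 < weight I a f" by (rule pos_mass_imp_weight)
    have "p' \<noteq> k" using p'(2) k(1) by auto
    then have "(p', k) \<in> extremal_types p q" using in_types[OF f p'(1)] k(1) by blast
    then show ?thesis using p' pq k by (auto simp: extremal_types_def)
  qed
  obtain \<sigma> where \<sigma>: "\<sigma> \<in> transversals I" "0 < weight I a \<sigma>"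
    using pos_mass_imp_weight[OF m0] unfolding defect_refl by blast
  have supp: "k = \<sigma> i \<or> (\<sigma> i = p \<and> k = q) \<or> (\<sigma> i = q \<and> k = p)"
    if i: "i \<in> I" "k \<in> I" "a i k \<noteq> 0" for i k
  proof (rule ccontr)
    assume neg: "\<not> ?thesis"
    have "0 < a i k" using nonneg[OF i(1,2)] i(3) by simp
    moreover have "0 < a i' (\<sigma> i')" if "i' \<in> I" for i'
    proof -
      have "a i' (\<sigma> i') \<noteq> 0"
        using \<sigma>(2) that prod_zero[OF finite_index, of "\<lambda>i. a i (\<sigma> i)"]
        unfolding weight_def by (metis less_irrefl)
      moreover have "\<sigma> i' \<in> I" using \<sigma> that by auto
      ultimately show ?thesis using nonneg[OF that] by (simp add: less_le)
    qed
    ultimately have "0 < weight I a (\<sigma>(i := k))"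
      unfolding weight_fun_upd[OF finite_index i(1)] by (intro mult_pos_pos prod_pos) auto
    then have "(\<sigma> i, k) \<in> extremal_types p q"
      using in_types[OF fun_upd_transversal[OF finite_index \<sigma>(1) i(1,2)]] neg \<sigma>(1) i by auto
    then consider "k = \<sigma> i" | "\<sigma> i = p" "x k < 0" | "\<sigma> i = q" "0 < x k"
      unfolding extremal_types_def by blast
    then show False by cases (use neg N[OF i(2)] P[OF i(2)] in auto)
  qed
  \<comment> \<open>The rows that \<open>\<sigma>\<close> sends to \<open>p\<close> or \<open>q\<close> live on these two columns, and the kernel equation with
      \<open>x q = - x p\<close> makes both entries equal.\<close>
  have entries: "a i k = (if \<sigma> i \<in> {p, q} then if k \<in> {p, q} then 1 / 2 else 0 else of_bool (k = \<sigma> i))"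
    if i: "i \<in> I" "k \<in> I" for i k
  proof (cases "\<sigma> i \<in> {p, q}")
    case True
    have zero: "a i l = 0" if "l \<in> I - {p, q}" for l using supp[of i l] i True that by auto
    have two: "sum g I = g p + g q" if "\<And>l. l \<in> I - {p, q} \<Longrightarrow> g l = 0" for g :: "'a \<Rightarrow> real"
    proof -
      have "sum g I = sum g {p, q}" using that pq by (intro sum.mono_neutral_right) auto
      then show ?thesis using pq by (subst (asm) sum.insert) auto
    qed
    have "a i p + a i q = 1" using two[of "a i"] zero row_sum[OF i(1)] by simp
    moreover have "x p * a i p + x q * a i q = 0"
      using two[of "\<lambda>l. x l * a i l"] zero kernel[OF i(1)] by simp
    then have "a i p = a i q" using opp pq by simp
    ultimately show ?thesis using True zero i by auto
  next
    case False
    then have zero: "a i l = 0" if "l \<in> I - {\<sigma> i}" for l using supp[of i l] i that by auto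
    have "\<sigma> i \<in> I" using \<sigma> i by auto
    then have "a i (\<sigma> i) = 1"
      using row_sum[OF i(1)] sum.remove[OF finite_index, of "\<sigma> i" "a i"] zero by simp
    then show ?thesis using False zero i by auto
  qed
  have "p \<noteq> q" using pq(2,4) by auto
  then show ?thesis using that[OF pq(1,3) _ \<sigma>(1)] entries by blast
qed

end

section \<open>Permanents of matrices\<close>

lemma transversal_permutes:
  assumes "finite I" "f \<in> transversals I"
  shows "(\<lambda>k. if k \<in> I then f k else k) permutes I"
proof -
  have "I \<subseteq> f ` I"
  proof
    fix k assume "k \<in> I"
    then have "card {i \<in> I. f i = k} = 1" using assms by simp
    then have "{i \<in> I. f i = k} \<noteq> {}" by force
    then show "k \<in> f ` I" by auto
  qed
  moreover have "f ` I \<subseteq> I" using assms by auto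
  ultimately have "bij_betw f I I"
    using finite_surj_inj[OF assms(1)] by (intro bij_betw_imageI equalityI)
  then have "bij_betw (\<lambda>k. if k \<in> I then f k else k) I I"
    by (subst bij_betw_cong[of I _ f]) auto
  then show ?thesis by (rule bij_imp_permutes) auto
qed

lemma permutes_restrict_transversal:
  assumes "\<sigma> permutes I"
  shows "restrict \<sigma> I \<in> transversals I"
proof -
  have "{i \<in> I. restrict \<sigma> I i = k} = {Hilbert_Choice.inv \<sigma> k}" if "k \<in> I" for k
    using that permutes_inverses[OF assms] permutes_in_image[OF permutes_inv[OF assms], of k]
    by auto
  moreover have "restrict \<sigma> I \<in> I \<rightarrow>\<^sub>E I"
    using assms by (auto simp: permutes_in_image)
  ultimately show ?thesis by simp
qed

lemma permanent_eq_mass: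
  assumes "A \<in> carrier_mat n n"
  shows "permanent A = mass {0..<n} (\<lambda>i j. A $$ (i, j)) p p"
proof -
  let ?I = "{0..<n}"
  have "permanent A = (\<Sum>\<sigma> | \<sigma> permutes ?I. \<Prod>i\<in>?I. A $$ (i, \<sigma> i))"
    using assms by (simp add: permanent_def)
  also have "\<dots> = (\<Sum>f\<in>transversals ?I. weight ?I (\<lambda>i j. A $$ (i, j)) f)"
  proof (rule sum.reindex_bij_witness[where i = "\<lambda>f k. if k \<in> ?I then f k else k"
        and j = "\<lambda>\<sigma>. restrict \<sigma> ?I"])
    fix f assume f: "f \<in> transversals ?I"
    show "(\<lambda>k. if k \<in> ?I then f k else k) \<in> {\<sigma>. \<sigma> permutes ?I}"
      using transversal_permutes[OF _ f] by simp
    show "(\<lambda>k\<in>?I. if k \<in> ?I then f k else k) = f"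
      using f by (auto simp: fun_eq_iff restrict_def PiE_def extensional_def)
  next
    fix \<sigma> assume "\<sigma> \<in> {\<sigma>. \<sigma> permutes ?I}"
    then have \<sigma>: "\<sigma> permutes ?I" by simp
    show "(\<lambda>k. if k \<in> ?I then restrict \<sigma> ?I k else k) = \<sigma>"
      using permutes_not_in[OF \<sigma>] by (auto simp: fun_eq_iff)
    show "restrict \<sigma> ?I \<in> transversals ?I"
      by (rule permutes_restrict_transversal[OF \<sigma>])
  qed (simp add: weight_def)
  finally show ?thesis by (simp add: mass_def defect_refl)
qed

lemma permanent_transpose:
  assumes "A \<in> carrier_mat n n"
  shows "permanent (transpose_mat A) = permanent A"
proof -
  let ?I = "{0..<n}"
  have "(\<Sum>\<sigma> | \<sigma> permutes ?I. \<Prod>i\<in>?I. A $$ (\<sigma> i, i)) = (\<Sum>\<sigma> | \<sigma> permutes ?I. \<Prod>i\<in>?I. A $$ (Hilbert_Choice.inv \<sigma> i, i))"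
    by (rule sum_permutations_inverse[where f = "\<lambda>\<sigma>. \<Prod>i\<in>?I. A $$ (\<sigma> i, i)"])
  also have "\<dots> = (\<Sum>\<sigma> | \<sigma> permutes ?I. \<Prod>i\<in>?I. A $$ (i, \<sigma> i))"
  proof (intro sum.cong refl)
    fix \<sigma> assume "\<sigma> \<in> {\<sigma>. \<sigma> permutes ?I}"
    then have \<sigma>: "\<sigma> permutes ?I" by simp
    show "(\<Prod>i\<in>?I. A $$ (Hilbert_Choice.inv \<sigma> i, i)) = (\<Prod>i\<in>?I. A $$ (i, \<sigma> i))"
      by (subst prod.permute[OF \<sigma>]) (simp add: permutes_inverses[OF \<sigma>])
  qed
  also have "(\<Sum>\<sigma> | \<sigma> permutes ?I. \<Prod>i\<in>?I. A $$ (\<sigma> i, i))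
      = (\<Sum>\<sigma> | \<sigma> permutes ?I. \<Prod>i\<in>?I. transpose_mat A $$ (i, \<sigma> i))"
  proof (intro sum.cong prod.cong refl)
    fix \<sigma> i assume "\<sigma> \<in> {\<sigma>. \<sigma> permutes ?I}" "i \<in> ?I"
    moreover from this have "\<sigma> i < n" using permutes_in_image[of \<sigma> ?I i] by simp
    ultimately show "A $$ (\<sigma> i, i) = transpose_mat A $$ (i, \<sigma> i)" using assms by simp
  qed
  finally show ?thesis using assms by (simp add: permanent_def)
qed

lemma permanent_permute:
  assumes A: "A \<in> carrier_mat n n" and B: "B \<in> carrier_mat n n"
    and \<rho>: "\<rho> permutes {0..<n}" and \<kappa>: "\<kappa> permutes {0..<n}"
    and AB: "\<And>i j. i < n \<Longrightarrow> j < n \<Longrightarrow> A $$ (i, j) = B $$ (\<rho> i, \<kappa> j)"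
  shows "permanent A = permanent B"
proof -
  let ?I = "{0..<n}" and ?f = "\<lambda>\<sigma>. \<Prod>i\<in>{0..<n}. B $$ (i, \<sigma> i)"
  have "permanent A = (\<Sum>\<sigma> | \<sigma> permutes ?I. \<Prod>i\<in>?I. A $$ (i, \<sigma> i))"
    using A by (simp add: permanent_def)
  also have "\<dots> = (\<Sum>\<sigma> | \<sigma> permutes ?I. ?f (\<kappa> \<circ> (\<sigma> \<circ> Hilbert_Choice.inv \<rho>)))"
  proof (intro sum.cong refl)
    fix \<sigma> assume "\<sigma> \<in> {\<sigma>. \<sigma> permutes ?I}"
    then have \<sigma>: "\<sigma> permutes ?I" by simp
    have "(\<Prod>i\<in>?I. A $$ (i, \<sigma> i)) = (\<Prod>i\<in>?I. B $$ (\<rho> i, \<kappa> (\<sigma> i)))"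
    proof (intro prod.cong refl)
      fix i assume "i \<in> ?I"
      moreover from this have "\<sigma> i < n" using permutes_in_image[OF \<sigma>, of i] by simp
      ultimately show "A $$ (i, \<sigma> i) = B $$ (\<rho> i, \<kappa> (\<sigma> i))" using AB by simp
    qed
    also have "\<dots> = ?f (\<kappa> \<circ> (\<sigma> \<circ> Hilbert_Choice.inv \<rho>))"
      by (subst (2) prod.permute[OF \<rho>]) (simp add: permutes_inverses[OF \<rho>])
    finally show "(\<Prod>i\<in>?I. A $$ (i, \<sigma> i)) = ?f (\<kappa> \<circ> (\<sigma> \<circ> Hilbert_Choice.inv \<rho>))" .
  qed
  also have "\<dots> = (\<Sum>\<sigma> | \<sigma> permutes ?I. ?f (\<kappa> \<circ> \<sigma>))"
    by (rule sum_permutations_compose_right[OF permutes_inv[OF \<rho>],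
          where f = "\<lambda>\<sigma>. ?f (\<kappa> \<circ> \<sigma>)", symmetric])
  also have "\<dots> = (\<Sum>\<sigma> | \<sigma> permutes ?I. ?f \<sigma>)"
    by (rule setum_permutations_compose_left[OF \<kappa>, where f = ?f, symmetric])
  finally show ?thesis using B by (simp add: permanent_def)
qed

section \<open>The extremal matrix\<close>

abbreviation J2_plus_id :: "nat \<Rightarrow> real mat" where
  "J2_plus_id n \<equiv> diag_block_mat [J2, 1\<^sub>m (n - 2)]"

lemma J2_plus_id_carrier: "2 \<le> n \<Longrightarrow> J2_plus_id n \<in> carrier_mat n n"
  by (auto simp: J2_def Let_def)

lemma J2_plus_id_index:
  assumes "i < n" "j < n"  "2 \<le> n"
  shows "J2_plus_id n $$ (i, j) = (if i < 2 then if j < 2 then 1 / 2 else 0 else of_bool (i = j))"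
  using assms by (auto simp: J2_def Let_def)

text \<open>The identity block forces \<open>\<sigma> i = i\<close> for \<open>i \<ge> 2\<close>, so only the identity and the transposition
  of \<open>0\<close> and \<open>1\<close> contribute, each with \<open>1 / 4\<close>.\<close>

lemma permanent_J2_plus_id:
  assumes n: "2 \<le> n"
  shows "permanent (J2_plus_id n) = 1 / 2"
proof -
  let ?I = "{0..<n}" and ?B = "J2_plus_id n"
  let ?t = "Transposition.transpose 0 (1::nat)"
  let ?f = "\<lambda>\<sigma>. \<Prod>i\<in>?I. ?B $$ (i, \<sigma> i)"
  have t: "?t permutes ?I" using n by (intro permutes_swap_id) auto
  have ne: "?t \<noteq> id" by (metis id_apply transpose_apply_first zero_neq_one)
  have zero: "?f \<sigma> = 0" if \<sigma>: "\<sigma> permutes ?I" "\<sigma> \<noteq> id" "\<sigma> \<noteq> ?t" for \<sigma>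
  proof (rule ccontr)
    assume nz: "?f \<sigma> \<noteq> 0"
    have fix': "\<sigma> i = i" if i: "2 \<le> i" for i
    proof (cases "i < n")
      case True
      then have "\<sigma> i < n" using permutes_in_image[OF \<sigma>(1), of i] by simp
      moreover have "?B $$ (i, \<sigma> i) \<noteq> 0" using nz True by (auto simp: prod_zero_iff)
      ultimately show ?thesis using J2_plus_id_index[OF True _ n, of "\<sigma> i"] i by (auto split: if_splits)
    next
      case False
      then show ?thesis using permutes_not_in[OF \<sigma>(1)] by simp
    qed
    have "\<sigma> permutes {0, 1}"
      using fix' by (intro permutes_superset[OF \<sigma>(1)]) auto
    then have "\<sigma> = id \<or> \<sigma> = ?t" by (simp add: permutes_doubleton_iff)
    with \<sigma> show False by simp
  qed
  have split: "?f \<sigma> = 1 / 4" if "\<sigma> 0 < 2" "\<sigma> 1 < 2" "\<And>i. 2 \<le> i \<Longrightarrow> \<sigma> i = i" for \<sigma>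
  proof -
    have "?I = {0, 1} \<union> {2..<n}" using n by auto
    then have "?f \<sigma> = (\<Prod>i\<in>{0, 1}. ?B $$ (i, \<sigma> i)) * (\<Prod>i\<in>{2..<n}. ?B $$ (i, \<sigma> i))"
      by (simp only:) (rule prod.union_disjoint, auto)
    also have "(\<Prod>i\<in>{2..<n}. ?B $$ (i, \<sigma> i)) = 1"
      using that n by (intro prod.neutral ballI) (simp add: J2_plus_id_index del: diag_block_mat.simps)
    also have "(\<Prod>i\<in>{0, 1}. ?B $$ (i, \<sigma> i)) = 1 / 4"
      using that n by (simp add: J2_plus_id_index del: diag_block_mat.simps)
    finally show ?thesis by simp
  qed
  have "permanent ?B = sum ?f {\<sigma>. \<sigma> permutes ?I}"
    using J2_plus_id_carrier[OF n] by (simp add: permanent_def del: diag_block_mat.simps)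
  also have "\<dots> = sum ?f {id, ?t}"
    using zero t permutes_id finite_permutations[of ?I] by (intro sum.mono_neutral_right) auto
  also have "\<dots> = ?f id + ?f ?t" using ne by (subst sum.insert) auto
  also have "?f id = 1 / 4" by (rule split) auto
  also have "?f ?t = 1 / 4" by (rule split) (auto simp: Transposition.transpose_def)
  finally show ?thesis by simp
qed

lemma permutation_mat_sandwich:
  assumes B: "B \<in> carrier_mat n n" and \<sigma>: "\<sigma> permutes {0..<n}" and \<tau>: "\<tau> permutes {0..<n}"
  shows "mat n n (\<lambda>(i, j). if j = \<sigma> i then 1 else 0) * B
      * mat n n (\<lambda>(i, j). if j = Hilbert_Choice.inv \<tau> i then 1 else 0)
      = mat n n (\<lambda>(i, j). (B $$ (\<sigma> i, \<tau> j) :: real))" (is "?P * B * ?Q = ?R")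
proof (rule eq_matI)
  fix i j assume "i < dim_row ?R" "j < dim_col ?R"
  then have ij: "i < n" "j < n" by auto
  have \<sigma>i: "\<sigma> i < n" and \<tau>j: "\<tau> j < n"
    using ij permutes_in_image[OF \<sigma>, of i] permutes_in_image[OF \<tau>, of j] by auto
  have left: "(?P * B) $$ (i, k) = B $$ (\<sigma> i, k)" if "k < n" for k
  proof -
    have "(?P * B) $$ (i, k) = (\<Sum>l\<in>{0..<n}. (if l = \<sigma> i then 1 else 0) * B $$ (l, k))"
      using B ij that by (simp add: scalar_prod_def)
    also have "\<dots> = (\<Sum>l\<in>{0..<n}. if l = \<sigma> i then B $$ (l, k) else 0)"
      by (intro sum.cong) auto
    finally show ?thesis using \<sigma>i by simp
  qed
  have "(?P * B * ?Q) $$ (i, j) = (\<Sum>k\<in>{0..<n}. (?P * B) $$ (i, k) * (if j = Hilbert_Choice.inv \<tau> k then 1 else 0))"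
    using B ij by (simp add: scalar_prod_def)
  also have "\<dots> = (\<Sum>k\<in>{0..<n}. if k = \<tau> j then B $$ (\<sigma> i, k) else 0)"
    by (intro sum.cong) (auto simp: left permutes_inverses[OF \<tau>])
  also have "\<dots> = B $$ (\<sigma> i, \<tau> j)" using \<tau>j by simp
  finally show "(?P * B * ?Q) $$ (i, j) = ?R $$ (i, j)" using ij by simp
qed (use B in auto)

text \<open>Multiplication by permutation matrices expressed entrywise. The right factor permutes columns by
  the inverse of its permutation, so the witnesses on the two sides are inverse to each other there.\<close>

lemma permutation_equivalent_iff:
  assumes A: "A \<in> carrier_mat n n" and B: "B \<in> carrier_mat n n"
  shows "(\<exists>P Q. permutation_mat n P \<and> permutation_mat n Q \<and> A = P * B * Q) \<longleftrightarrow>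
    (\<exists>\<sigma> \<tau>. \<sigma> permutes {0..<n} \<and> \<tau> permutes {0..<n} \<and>
      (\<forall>i<n. \<forall>j<n. A $$ (i, j) = B $$ (\<sigma> i, \<tau> j)))" (is "?L \<longleftrightarrow> ?R")
proof
  assume ?L
  then obtain \<sigma> \<tau> where *: "\<sigma> permutes {0..<n}" "\<tau> permutes {0..<n}"
    "A = mat n n (\<lambda>(i, j). if j = \<sigma> i then 1 else 0) * B * mat n n (\<lambda>(i, j). if j = \<tau> i then 1 else 0)"
    unfolding permutation_mat_def by blast
  have "A = mat n n (\<lambda>(i, j). B $$ (\<sigma> i, Hilbert_Choice.inv \<tau> j))"
    using permutation_mat_sandwich[OF B *(1) permutes_inv[OF *(2)]] *(3)
    by (simp add: permutes_inv_inv[OF *(2)])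
  then show ?R using *(1) permutes_inv[OF *(2)] by (intro exI[of _ \<sigma>] exI[of _ "Hilbert_Choice.inv \<tau>"]) simp
next
  assume ?R
  then obtain \<sigma> \<tau> where *: "\<sigma> permutes {0..<n}" "\<tau> permutes {0..<n}"
    "\<And>i j. i < n \<Longrightarrow> j < n \<Longrightarrow> A $$ (i, j) = B $$ (\<sigma> i, \<tau> j)" by blast
  have "A = mat n n (\<lambda>(i, j). B $$ (\<sigma> i, \<tau> j))" using A *(3) by (intro eq_matI) auto
  also have "\<dots> = mat n n (\<lambda>(i, j). if j = \<sigma> i then 1 else 0) * B
      * mat n n (\<lambda>(i, j). if j = Hilbert_Choice.inv \<tau> i then 1 else 0)"
    by (rule permutation_mat_sandwich[OF B *(1,2), symmetric])
  finally show ?L using *(1) permutes_inv[OF *(2)] unfolding permutation_mat_def by blast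
qed

section \<open>Singular stochastic matrices\<close>

lemma det_nonzero_imp_invertible:
  fixes A :: "'a :: field mat"
  assumes A: "A \<in> carrier_mat n n" and "det A \<noteq> 0"
  shows "invertible_mat A"
proof -
  obtain B where B: "B \<in> carrier_mat n n" "B * A = 1\<^sub>m n" "A * B = 1\<^sub>m n"
    using det_non_zero_imp_unit[OF assms, where b = "()"] by (auto simp: Units_def ring_mat_def)
  then have "inverts_mat A B" "inverts_mat B A" using A by (auto simp: inverts_mat_def)
  then show ?thesis using A by (auto simp: invertible_mat_def)
qed

lemma ex_permutes_to_0_1:
  assumes "p < n" "q < n" "p \<noteq> (q::nat)"
  obtains \<kappa> where "\<kappa> permutes {0..<n}" "\<kappa> p = 0" "\<kappa> q = 1"
proof -
  let ?q = "Transposition.transpose 0 p q"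
  let ?k = "Transposition.transpose 1 ?q \<circ> Transposition.transpose 0 p"
  have n: "1 < n" using assms by linarith
  have q: "?q \<noteq> 0" "?q < n" using assms by (auto simp: Transposition.transpose_def)
  have "?k permutes {0..<n}" using assms q n
    by (intro permutes_compose permutes_swap_id) auto
  then show ?thesis using that[of ?k] q by (simp add: Transposition.transpose_def)
qed

text \<open>The structure found in the equality case becomes the standard form after relabelling the
  columns by some \<open>\<kappa>\<close> with \<open>\<kappa> p = 0\<close> and \<open>\<kappa> q = 1\<close>, and the rows by \<open>\<kappa> \<circ> \<sigma>\<close>.\<close>

lemma row_stochastic_case:
  fixes A :: "real mat"
  assumes n: "2 \<le> n" and A: "A \<in> carrier_mat n n" and singular: "det A = 0"
    and stoch: "row_stochastic A"
  shows "permanent A \<le> 1 / 2"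
    and "permanent A = 1 / 2 \<Longrightarrow> \<exists>\<sigma> \<tau>. \<sigma> permutes {0..<n} \<and> \<tau> permutes {0..<n} \<and>
      (\<forall>i<n. \<forall>j<n. A $$ (i, j) = J2_plus_id n $$ (\<sigma> i, \<tau> j))"
proof -
  let ?I = "{0..<n}" and ?a = "\<lambda>i j. A $$ (i, j)"
  obtain v where v: "v \<in> carrier_vec n" "v \<noteq> 0\<^sub>v n" "A *\<^sub>v v = 0\<^sub>v n"
    using singular det_0_iff_vec_prod_zero_field[OF A] by blast
  obtain j where j: "j \<in> ?I" "v $ j \<noteq> 0"
    using v(1,2) by (metis atLeastLessThan_iff carrier_vecD eq_vecI index_zero_vec le0)
  interpret stochastic_kernel ?I ?a "\<lambda>j. v $ j"
  proof
    fix i assume i: "i \<in> ?I"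
    have "(\<Sum>j\<in>?I. A $$ (i, j) * v $ j) = (A *\<^sub>v v) $ i"
      using i A v(1) by (simp add: scalar_prod_def)
    then show "(\<Sum>j\<in>?I. v $ j * A $$ (i, j)) = 0" using v(3) i by (simp add: mult.commute)
  qed (use A stoch in \<open>auto simp: row_stochastic_def\<close>)
  show "permanent A \<le> 1 / 2"
    using mass_le_half[OF j] permanent_eq_mass[OF A] by simp
  assume "permanent A = 1 / 2"
  then have half: "mass ?I ?a j j = 1 / 2" using permanent_eq_mass[OF A] by simp
  obtain p q \<sigma> where pq: "p \<in> ?I" "q \<in> ?I" "p \<noteq> q" and \<sigma>: "\<sigma> \<in> transversals ?I"
    and entries: "\<forall>i\<in>?I. \<forall>k\<in>?I.
       A $$ (i, k) = (if \<sigma> i \<in> {p, q} then if k \<in> {p, q} then 1 / 2 else 0 else of_bool (k = \<sigma> i))"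
    using equality_structure[OF j half] .
  obtain \<kappa> where \<kappa>: "\<kappa> permutes ?I" "\<kappa> p = 0" "\<kappa> q = 1"
    using ex_permutes_to_0_1[of p n q] pq by auto
  let ?s = "\<lambda>k. if k \<in> ?I then \<sigma> k else k"
  have s: "?s permutes ?I" using transversal_permutes[OF _ \<sigma>] by simp
  have inj: "\<kappa> k = \<kappa> l \<longleftrightarrow> k = l" for k l
    using permutes_inj[OF \<kappa>(1)] by (simp only: inj_eq)
  have lt2: "\<kappa> k < 2 \<longleftrightarrow> k \<in> {p, q}" for k
  proof -
    have "\<kappa> k < 2 \<longleftrightarrow> \<kappa> k = \<kappa> p \<or> \<kappa> k = \<kappa> q" by (simp add: less_2_cases_iff \<kappa>)
    then show ?thesis by (simp only: inj insert_iff empty_iff simp_thms)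
  qed
  have "A $$ (i, k) = J2_plus_id n $$ ((\<kappa> \<circ> ?s) i, \<kappa> k)" if "i < n" "k < n" for i k
  proof -
    have "\<sigma> i \<in> ?I" using \<sigma> that by auto
    then have lt: "\<kappa> (\<sigma> i) < n" "\<kappa> k < n"
      using that permutes_in_image[OF \<kappa>(1), of "\<sigma> i"] permutes_in_image[OF \<kappa>(1), of k] by auto
    have "A $$ (i, k) = (if \<sigma> i \<in> {p, q} then if k \<in> {p, q} then 1 / 2 else 0 else of_bool (k = \<sigma> i))"
      using entries that by simp
    also have "\<dots> = J2_plus_id n $$ (\<kappa> (\<sigma> i), \<kappa> k)"
      unfolding J2_plus_id_index[OF lt n] lt2 inj eq_commute[of k] ..
    finally show ?thesis using that by simp
  qed
  then show "\<exists>\<sigma> \<tau>. \<sigma> permutes ?I \<and> \<tau> permutes ?I \<and>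
      (\<forall>i<n. \<forall>j<n. A $$ (i, j) = J2_plus_id n $$ (\<sigma> i, \<tau> j))"
    using permutes_compose[OF s \<kappa>(1)] \<kappa>(1) by blast
qed

theorem corollary1p2:
  fixes n :: nat and A :: "real mat"
  assumes "n \<ge> 2"
    and "A \<in> carrier_mat n n"
    and "\<not> invertible_mat A"
    and "row_stochastic A \<or> column_stochastic A"
  shows "permanent A \<le> 1 / 2 \<and>
    (permanent A = 1 / 2 \<longleftrightarrow>
      (\<exists>P Q. permutation_mat n P \<and> permutation_mat n Q \<and>
        A = P * diag_block_mat [J2, 1\<^sub>m (n - 2)] * Q))"
proof -
  note n = assms(1) and A = assms(2)
  note B = J2_plus_id_carrier[OF n]
  have det0: "det A = 0" using det_nonzero_imp_invertible[OF A] assms(3) by blast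
  let ?sim = "\<exists>\<sigma> \<tau>. \<sigma> permutes {0..<n} \<and> \<tau> permutes {0..<n} \<and>
      (\<forall>i<n. \<forall>j<n. A $$ (i, j) = J2_plus_id n $$ (\<sigma> i, \<tau> j))"
  have half: "permanent A = 1 / 2" if ?sim
    using that permanent_permute[OF A B] permanent_J2_plus_id[OF n] by metis
  have bound: "permanent A \<le> 1 / 2 \<and> (permanent A = 1 / 2 \<longrightarrow> ?sim)"
  proof (cases "row_stochastic A")
    case True
    then show ?thesis using row_stochastic_case[OF n A det0] by blast
  next
    case False
    then have col: "column_stochastic A" using assms(4) by simp
    let ?T = "transpose_mat A"
    have T: "?T \<in> carrier_mat n n" using A by simp
    have sing: "det ?T = 0" using det0 det_transpose[OF A] by simp
    have stoch: "row_stochastic ?T"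
      using col A by (auto simp: row_stochastic_def column_stochastic_def)
    have ?sim if half: "permanent A = 1 / 2"
    proof -
      obtain \<sigma> \<tau> where *: "\<sigma> permutes {0..<n}" "\<tau> permutes {0..<n}"
        "\<And>i j. i < n \<Longrightarrow> j < n \<Longrightarrow> ?T $$ (i, j) = J2_plus_id n $$ (\<sigma> i, \<tau> j)"
        using row_stochastic_case(2)[OF n T sing stoch] half permanent_transpose[OF A] by auto
      have "A $$ (i, j) = J2_plus_id n $$ (\<tau> i, \<sigma> j)" if "i < n" "j < n" for i j
      proof -
        have "\<sigma> j < n" "\<tau> i < n"
          using that permutes_in_image[OF *(1)] permutes_in_image[OF *(2)]
          by (metis atLeastLessThan_iff le0)+
        then show ?thesis
          using *(3)[OF that(2,1)] that A n
          by (auto simp: J2_plus_id_index simp del: diag_block_mat.simps)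
      qed
      then show ?thesis using * by blast
    qed
    then show ?thesis
      using row_stochastic_case(1)[OF n T sing stoch] permanent_transpose[OF A] by simp
  qed
  show ?thesis using bound half unfolding permutation_equivalent_iff[OF A B] by blast
qed

end
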